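(* Let $d\geqslant2$, let $(\widetilde L^i_t)_{t\geqslant0}$, $i=1,\dots,d$, be mutually independent real-valued Lévy processes with characteristic triplets $(\tilde b_i,0,\tilde\lambda_i)$, and let $(\boldsymbol{T}_t)_{t\geqslant0}$ be a $d$-dimensional subordinator, independent of them, with triplet $(\boldsymbol{c},0,\rho)$, $\boldsymbol{c}=(c_1,\dots,c_d)\in\mathbb{R}^d_+$, $\operatorname{supp}\rho\subset\mathbb{R}^d_+$. Suppose that the Lévy measure $\Lambda$ on $\mathbb{R}^d$ is given by $$\Lambda(B)=\int_{\mathbb{R}^d_+}\mu_{\boldsymbol{s}}(B)\,\rho(\mathrm{d}\boldsymbol{s})+\sum_{i=1}^dc_i\,\tilde\lambda_i\big(\{y\in\mathbb{R}:y\boldsymbol{e}_i\in B\}\big)$$ for Borel $B\subset\mathbb{R}^d\setminus\{\boldsymbol{0}\}$ (and $\Lambda(\{\boldsymbol{0}\})=0$), and that $$\tilde\lambda_i\big((-\varepsilon,0)\big)>0\quad\text{and}\quad\tilde\lambda_i\big((0,\varepsilon)\big)>0\quad\text{for any }i=1,\dots,d\text{ and }\varepsilon>0.$$ If $\boldsymbol{c}\in\mathbb{R}^d_{++}$ or $\mathbb{R}^d_{++}\cap\operatorname{supp}\rho\neq\varnothing$, then $\boldsymbol{0}\in\operatorname{int}\operatorname{conv}\operatorname{supp}\Lambda_\varepsilon$ for any $\varepsilon>0$.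
   Context: $\mathbb{R}_+=[0,\infty)$, $\mathbb{R}_{++}=(0,\infty)$, and $\boldsymbol{e}_i$ is the $i$-th canonical basis vector of $\mathbb{R}^d$. A $d$-dimensional subordinator is a Lévy process in $\mathbb{R}^d$ whose components have non-decreasing trajectories; $\boldsymbol{c}$ is its drift and $\rho$ its Lévy measure. For $\boldsymbol{s}=(s_1,\dots,s_d)\in\mathbb{R}^d_+$, $\mu_{\boldsymbol{s}}$ is the law of $(\widetilde L^1_{s_1},\dots,\widetilde L^d_{s_d})$, i.e. the product measure of the laws of $\widetilde L^j_{s_j}$. The measure $\Lambda$ is the Lévy measure of the Lévy process $\boldsymbol{L}_t=\big(\widetilde L^1_{T^1_t},\dots,\widetilde L^d_{T^d_t}\big)$, where $T^i$ is the $i$-th component of $\boldsymbol{T}$ (a known result). $\Lambda_\varepsilon(A)=\Lambda\big(A\cap B(\boldsymbol{0},\varepsilon)\big)$ for Borel $A\subset\mathbb{R}^d$, where $B(\boldsymbol{0},\varepsilon)$ is the open ball of radius $\varepsilon$ centred at the origin. $\operatorname{supp}$ is the closed support of a measure, $\operatorname{conv}$ the convex hull, $\operatorname{int}$ the interior in $\mathbb{R}^d$. *)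

theory Defs
  imports "HOL-Probability.Probability"
begin

text \<open>Processes are indexed by \<^typ>\<open>real\<close>, but only their values at times \<open>t \<ge> 0\<close> matter.\<close>

definition cadlag :: "(real \<Rightarrow> 'a::topological_space) \<Rightarrow> bool" where
  "cadlag f \<longleftrightarrow>
     (\<forall>t\<ge>0. continuous (at_right t) f) \<and> (\<forall>t>0. \<exists>l. (f \<longlongrightarrow> l) (at_left t))"

definition levy_process :: "'w measure \<Rightarrow> (real \<Rightarrow> 'w \<Rightarrow> 'a::euclidean_space) \<Rightarrow> bool" where
  "levy_process M X \<longleftrightarrow>
     prob_space M \<and>
     (\<forall>t\<ge>0. X t \<in> borel_measurable M) \<and>
     (AE \<omega> in M. X 0 \<omega> = 0) \<and>
     (\<forall>(n::nat) (t :: nat \<Rightarrow> real). 0 \<le> t 0 \<and> mono t \<longrightarrow>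
        prob_space.indep_vars M (\<lambda>_. borel) (\<lambda>k \<omega>. X (t (Suc k)) \<omega> - X (t k) \<omega>) {..<n}) \<and>
     (\<forall>s\<ge>0. \<forall>t\<ge>0. distr M borel (\<lambda>\<omega>. X (s + t) \<omega> - X s \<omega>) = distr M borel (X t)) \<and>
     (\<forall>t\<ge>0. \<forall>e>0.
        ((\<lambda>s. measure M {\<omega> \<in> space M. dist (X s \<omega>) (X t \<omega>) > e}) \<longlongrightarrow> 0) (at t within {0..})) \<and>
     (AE \<omega> in M. cadlag (\<lambda>t. X t \<omega>))"

definition levy_measure :: "'a::euclidean_space measure \<Rightarrow> bool" where
  "levy_measure \<nu> \<longleftrightarrow>
     sets \<nu> = sets borel \<and> emeasure \<nu> {0} = 0 \<and>
     (\<integral>\<^sup>+ x. ennreal (min 1 ((norm x)\<^sup>2)) \<partial>\<nu>) < \<infinity>"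

text \<open>The Levy--Khintchine exponent, with truncation function \<open>x \<mapsto> x 1{norm x \<le> 1}\<close>.
  The Gaussian covariance is given as a linear operator.\<close>

definition levy_exponent ::
  "'a::euclidean_space \<Rightarrow> ('a \<Rightarrow> 'a) \<Rightarrow> 'a measure \<Rightarrow> 'a \<Rightarrow> complex" where
  "levy_exponent b A \<nu> u =
     \<i> * of_real (b \<bullet> u) - of_real (u \<bullet> A u) / 2 +
     (CLINT x|\<nu>. iexp (u \<bullet> x) - 1 - \<i> * of_real ((u \<bullet> x) * indicator (cball 0 1) x))"

definition has_characteristic_triplet ::
  "'w measure \<Rightarrow> (real \<Rightarrow> 'w \<Rightarrow> 'a::euclidean_space) \<Rightarrow> 'a \<Rightarrow> ('a \<Rightarrow> 'a) \<Rightarrow> 'a measure \<Rightarrow> bool" where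
  "has_characteristic_triplet M X b A \<nu> \<longleftrightarrow>
     linear A \<and> (\<forall>u v. A u \<bullet> v = u \<bullet> A v) \<and> (\<forall>u. 0 \<le> u \<bullet> A u) \<and>
     levy_measure \<nu> \<and>
     (\<forall>t\<ge>0. \<forall>u. (CLINT \<omega>|M. iexp (u \<bullet> X t \<omega>)) = exp (of_real t * levy_exponent b A \<nu> u))"

text \<open>The triplet whose first entry is the drift \<open>c\<close>, i.e. the triplet for the zero truncation
  function. It requires \<open>\<nu>\<close> to integrate \<open>min 1 (norm x)\<close>; then
  \<open>b = c + \<integral>\<^bsub>norm x \<le> 1\<^esub> x d\<nu>\<close>, and the exponent is
  \<open>i (c \<bullet> u) - (u \<bullet> A u) / 2 + \<integral> (exp (i (u \<bullet> x)) - 1) d\<nu>\<close>.\<close>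

definition has_drift_triplet ::
  "'w measure \<Rightarrow> (real \<Rightarrow> 'w \<Rightarrow> 'a::euclidean_space) \<Rightarrow> 'a \<Rightarrow> ('a \<Rightarrow> 'a) \<Rightarrow> 'a measure \<Rightarrow> bool" where
  "has_drift_triplet M X c A \<nu> \<longleftrightarrow>
     (\<integral>\<^sup>+ x. ennreal (min 1 (norm x)) \<partial>\<nu>) < \<infinity> \<and>
     has_characteristic_triplet M X (c + (LINT x:cball 0 1|\<nu>. x)) A \<nu>"

definition subordinator :: "'w measure \<Rightarrow> (real \<Rightarrow> 'w \<Rightarrow> real^'d) \<Rightarrow> bool" where
  "subordinator M T \<longleftrightarrow>
     levy_process M T \<and>
     (AE \<omega> in M. \<forall>i. mono_on {0..} (\<lambda>t. T t \<omega> $ i))"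


abbreviation path_algebra :: "(real \<Rightarrow> 'a::topological_space) measure" where
  "path_algebra \<equiv> PiM {0..} (\<lambda>_. borel)"

definition process_path :: "(real \<Rightarrow> 'w \<Rightarrow> 'a) \<Rightarrow> 'w \<Rightarrow> real \<Rightarrow> 'a" where
  "process_path X \<omega> = (\<lambda>t\<in>{0..}. X t \<omega>)"

definition indep_processes ::
  "'w measure \<Rightarrow> ('i \<Rightarrow> real \<Rightarrow> 'w \<Rightarrow> 'a::topological_space) \<Rightarrow> bool" where
  "indep_processes M L \<longleftrightarrow>
     prob_space.indep_vars M (\<lambda>_. path_algebra) (\<lambda>i. process_path (L i)) UNIV"

text \<open>Independence of \<open>T\<close> from the whole family \<open>L\<close>. Since \<^const>\<open>prob_space.indep_var\<close> forces both
  variables to have values in the same type, this is stated for the generated sigma-algebras.\<close>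

definition indep_of_family ::
  "'w measure \<Rightarrow> (real \<Rightarrow> 'w \<Rightarrow> 'b::topological_space) \<Rightarrow>
     ('i \<Rightarrow> real \<Rightarrow> 'w \<Rightarrow> 'a::topological_space) \<Rightarrow> bool" where
  "indep_of_family M T L \<longleftrightarrow>
     prob_space.indep_set M
       (sets (vimage_algebra (space M) (process_path T) path_algebra))
       (sets (vimage_algebra (space M) (\<lambda>\<omega> i. process_path (L i) \<omega>)
          (PiM UNIV (\<lambda>_. path_algebra))))"

definition nonneg_orthant :: "(real^'d) set" where
  "nonneg_orthant = {s. \<forall>i. 0 \<le> s $ i}"

definition pos_orthant :: "(real^'d) set" where
  "pos_orthant = {s. \<forall>i. 0 < s $ i}"

definition measure_support :: "'a::topological_space measure \<Rightarrow> 'a set" where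
  "measure_support \<mu> = {x. \<forall>U. open U \<and> x \<in> U \<longrightarrow> 0 < emeasure \<mu> U}"

text \<open>For independent \<open>L j\<close> this is the product of the laws of the \<open>L j (s $ j)\<close>.\<close>

definition multitime_law :: "'w measure \<Rightarrow> ('d \<Rightarrow> real \<Rightarrow> 'w \<Rightarrow> real) \<Rightarrow> real^'d \<Rightarrow> (real^'d) measure"
  where "multitime_law M L s = distr M borel (\<lambda>\<omega>. \<chi> j. L j (s $ j) \<omega>)"

definition ball_restriction :: "'a::metric_space measure \<Rightarrow> 'a \<Rightarrow> real \<Rightarrow> 'a measure" where
  "ball_restriction \<mu> a \<epsilon> = density \<mu> (indicator (ball a \<epsilon>))"

lemma emeasure_ball_restriction:
  assumes "sets \<mu> = sets borel" "A \<in> sets borel"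
  shows "emeasure (ball_restriction \<mu> a \<epsilon>) A = emeasure \<mu> (A \<inter> ball a \<epsilon>)"
proof -
  have "ball a \<epsilon> \<in> sets \<mu>" "A \<in> sets \<mu>"
    using assms by auto
  then have "emeasure (ball_restriction \<mu> a \<epsilon>) A = emeasure \<mu> (ball a \<epsilon> \<inter> A)"
    unfolding ball_restriction_def by (subst emeasure_density) (simp_all add: indicator_inter_arith[symmetric])
  then show ?thesis
    by (simp add: Int_commute)
qed

end

theory Submission
  imports Defs
begin

text \<open>If the support of \<open>\<Lambda>\<^sub>\<epsilon>\<close> meets both halves of every coordinate axis, then \<open>0\<close> is an
  interior point of its convex hull. For \<open>c \<in> pos_orthant\<close> this holds because \<open>\<Lambda>\<close> charges every
  axis segment that the one-dimensional Levy measures charge. Otherwise it is enough that every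
  \<open>L i t\<close> with \<open>t > 0\<close> has full support: then \<open>\<mu>\<^sub>s\<close> charges every open set for \<open>s\<close> near a point of
  \<open>pos_orthant \<inter> supp \<rho>\<close>, hence so does \<open>\<Lambda>\<close> away from \<open>0\<close>.

  For the full support, the finite measures \<open>n (1 - cos x) P(L (t/n) \<in> dx)\<close> converge weakly to
  \<open>t (1 - cos x) \<nu>(dx)\<close> by Levy's continuity theorem. So for large \<open>n\<close> the support of \<open>L (t/n)\<close>
  contains some \<open>p \<in> (a, e)\<close> and some \<open>q \<in> (-e, -a')\<close>, with \<open>a, a' > 0\<close> independent of \<open>n\<close>. By
  independence of increments the support of \<open>L t\<close> contains all \<open>k p + (n - k) q\<close> with \<open>k \<le> n\<close>, a
  grid of mesh below \<open>2 e\<close> whose range grows with \<open>n\<close>.\<close>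

section \<open>Supports of measures and convex hulls\<close>

text \<open>A point outside the support has a null neighbourhood, which may be taken from a
  countable basis. The null basis sets together form a null set, so a set missing the support is
  null.\<close>

lemma measure_support_meets:
  fixes \<mu> :: "'a::second_countable_topology measure"
  assumes sets: "sets \<mu> = sets borel" and A: "A \<in> sets borel" and pos: "0 < emeasure \<mu> A"
  shows "\<exists>x\<in>A. x \<in> measure_support \<mu>"
proof (rule ccontr)
  assume contra: "\<not> ?thesis"
  obtain B :: "'a set set" where B: "countable B" "topological_basis B"
    using ex_countable_basis by blast
  let ?C = "{b \<in> B. emeasure \<mu> b = 0}"
  have "A \<subseteq> \<Union>?C"
  proof
    fix x assume "x \<in> A"
    then obtain U where U: "open U" "x \<in> U" "emeasure \<mu> U = 0"
      using contra by (auto simp: measure_support_def)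
    then obtain b where b: "b \<in> B" "x \<in> b" "b \<subseteq> U"
      using topological_basisE[OF B(2)] by metis
    have "emeasure \<mu> b = 0"
      using emeasure_mono[OF b(3), of \<mu>] U sets by simp
    with b show "x \<in> \<Union>?C" by auto
  qed
  moreover have "\<Union>?C \<in> null_sets \<mu>"
  proof -
    have "(\<Union>b\<in>?C. b) \<in> null_sets \<mu>"
      using B topological_basis_open[OF B(2)] sets
      by (intro null_sets_UN') auto
    then show ?thesis by simp
  qed
  ultimately have "emeasure \<mu> A = 0"
    using A sets by (metis null_sets_subset null_setsD1)
  with pos show False by simp
qed

text \<open>With \<open>d\<close> the dimension, \<open>y\<close> is the average of the
  \<open>d\<close> axis vectors \<open>(d * y $ i) *\<^sub>R axis i 1\<close>. For small
  \<open>y\<close> each of them lies on the segment between the two given points of its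
  axis.\<close>

lemma zero_in_interior_convex_hull_axes:
  fixes S :: "(real^'d::finite) set"
  assumes pos: "\<And>i. \<exists>p>0. p *\<^sub>R axis i 1 \<in> S" and neg: "\<And>i. \<exists>q<0. q *\<^sub>R axis i 1 \<in> S"
  shows "0 \<in> interior (convex hull S)"
proof -
  obtain p where p: "\<And>i. 0 < p i" "\<And>i. p i *\<^sub>R axis i 1 \<in> S"
    using pos by metis
  obtain q where q: "\<And>i. q i < 0" "\<And>i. q i *\<^sub>R axis i 1 \<in> S"
    using neg by metis
  define d where "d = real CARD('d)"
  have d: "0 < d" by (simp add: d_def)
  \<comment> \<open>The division by \<open>d\<close> makes up for the factor \<open>d\<close> by
    which the coordinates are stretched before averaging.\<close>
  define r where "r = Min (range (\<lambda>i. min (p i) (- q i) / d))"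
  have r: "0 < r"
    unfolding r_def using p q d by (subst Min_gr_iff) auto
  have r_le: "r \<le> min (p i) (- q i) / d" for i
    unfolding r_def by (rule Min_le) auto
  \<comment> \<open>The part of the \<open>i\<close>-th axis inside the hull is convex, hence an
    interval, and contains \<open>q i\<close> and \<open>p i\<close>.\<close>
  have seg: "z *\<^sub>R axis i 1 \<in> convex hull S" if z: "q i \<le> z" "z \<le> p i" for i z
  proof -
    have "convex ((\<lambda>z. z *\<^sub>R axis i (1::real)) -` (convex hull S))"
      by (intro convex_linear_vimage convex_convex_hull bounded_linear.linear
          bounded_linear_scaleR_left)
    then have "is_interval ((\<lambda>z. z *\<^sub>R axis i (1::real)) -` (convex hull S))"
      by (simp add: is_interval_convex_1)
    then show ?thesis
      using mem_is_interval_1_I[OF _ _ _ z, of "(\<lambda>z. z *\<^sub>R axis i 1) -` (convex hull S)"]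
        p(2)[of i] q(2)[of i]
      by (simp add: hull_inc)
  qed
  have "ball 0 r \<subseteq> convex hull S"
  proof
    fix y :: "real^'d" assume "y \<in> ball 0 r"
    then have y: "norm y < r" by simp
    have "(\<Sum>i\<in>UNIV. (1 / d) *\<^sub>R ((d * y $ i) *\<^sub>R axis i 1)) \<in> convex hull S"
    proof (rule convex_sum)
      show "(d * y $ i) *\<^sub>R axis i 1 \<in> convex hull S" for i
      proof (rule seg)
        have "\<bar>y $ i\<bar> \<le> min (p i) (- q i) / d"
          using component_le_norm_cart[of y i] y r_le[of i] by linarith
        then have "\<bar>y $ i\<bar> * d \<le> min (p i) (- q i)"
          using d by (simp add: pos_le_divide_eq)
        then have "\<bar>d * y $ i\<bar> \<le> min (p i) (- q i)"
          using d by (simp add: abs_mult mult.commute)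
        then show "q i \<le> d * y $ i" "d * y $ i \<le> p i" by linarith+
      qed
    qed (use d in \<open>auto simp: d_def\<close>)
    also have "(\<Sum>i\<in>UNIV. (1 / d) *\<^sub>R ((d * y $ i) *\<^sub>R axis i 1)) = y"
      using d by (simp add: vec_eq_iff axis_def if_distrib sum.delta cong: if_cong)
    finally show "y \<in> convex hull S" .
  qed
  with r show ?thesis
    by (auto simp: mem_interior)
qed

section \<open>Integrability and second differences of the Levy exponent\<close>

lemma integrable_levy_measure:
  fixes f :: "'a::euclidean_space \<Rightarrow> 'b::{banach, second_countable_topology}"
  assumes \<nu>: "levy_measure \<nu>" and [measurable]: "f \<in> borel_measurable borel"
    and bound: "\<And>x. norm (f x) \<le> C * min 1 ((norm x)\<^sup>2)"
  shows "integrable \<nu> f"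
proof -
  have [measurable_cong]: "sets \<nu> = sets borel"
    and fin: "(\<integral>\<^sup>+ x. ennreal (min 1 ((norm x)\<^sup>2)) \<partial>\<nu>) < \<infinity>"
    using \<nu> by (auto simp: levy_measure_def)
  have "integrable \<nu> (\<lambda>x. min 1 ((norm x)\<^sup>2))"
    by (rule integrableI_bounded) (use fin in auto)
  then have "integrable \<nu> (\<lambda>x. C * min 1 ((norm x)\<^sup>2))"
    by simp
  then show ?thesis
  proof (rule Bochner_Integration.integrable_bound)
    show "AE x in \<nu>. norm (f x) \<le> norm (C * min 1 ((norm x)\<^sup>2))"
      by (intro AE_I2 order_trans[OF bound]) simp
  qed simp
qed

text \<open>This makes \<open>(1 - cos x) \<nu>(dx)\<close> a finite measure for every Levy measure
  \<open>\<nu>\<close>.\<close>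

lemma one_minus_cos_le: "1 - cos x \<le> 2 * min 1 (x\<^sup>2)" for x :: real
proof -
  have "1 - cos x = 2 * (sin (x / 2))\<^sup>2"
    using cos_double_sin[of "x / 2"] by simp
  also have "(sin (x / 2))\<^sup>2 \<le> (x / 2)\<^sup>2"
    using abs_sin_x_le_abs_x[of "x / 2"] unfolding abs_le_square_iff .
  finally have "1 - cos x \<le> x\<^sup>2 / 2"
    by (simp add: power_divide)
  then have "1 - cos x \<le> 2 * x\<^sup>2"
    using zero_le_power2[of x] by linarith
  moreover have "1 - cos x \<le> 2"
    using cos_ge_minus_one[of x] by linarith
  ultimately show ?thesis by linarith
qed

text \<open>For \<open>\<bar>x\<bar> \<le> 1\<close> the compensator is the first-order Taylor term
  and the remainder is quadratic. For larger \<open>x\<close> it vanishes and the triangle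
  inequality gives the bound 2.\<close>

lemma levy_integrand_bound:
  fixes u x :: real
  shows "cmod (iexp (u * x) - 1 - \<i> * of_real (u * x * indicator (cball 0 1) x))
    \<le> (2 + u\<^sup>2) * min 1 (x\<^sup>2)"
proof (cases "\<bar>x\<bar> \<le> 1")
  case True
  then have "x\<^sup>2 \<le> 1"
    by (simp add: abs_square_le_1)
  have "cmod (iexp (u * x) - (\<Sum>k\<le>1. (\<i> * (u * x)) ^ k / fact k)) \<le> \<bar>u * x\<bar> ^ Suc 1 / fact (Suc 1)"
    by (rule iexp_approx1)
  then have "cmod (iexp (u * x) - 1 - \<i> * (u * x)) \<le> (u * x)\<^sup>2 / 2"
    by (simp add: numeral_2_eq_2 diff_diff_eq flip: power2_abs)
  also have "\<dots> \<le> (2 + u\<^sup>2) * x\<^sup>2"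
    by (simp add: algebra_simps power_mult_distrib)
  finally show ?thesis
    using True \<open>x\<^sup>2 \<le> 1\<close> by (simp add: min_def indicator_def dist_real_def)
next
  case False
  then have "1 < x\<^sup>2"
    by (simp add: abs_square_le_1 flip: not_le)
  have "cmod (iexp (u * x) - 1) \<le> cmod (iexp (u * x)) + cmod 1"
    by (rule norm_triangle_ineq4)
  also have "\<dots> = 2"
    by simp
  also have "\<dots> \<le> 2 + u\<^sup>2"
    by simp
  finally show ?thesis
    using False \<open>1 < x\<^sup>2\<close> by (simp add: min_def indicator_def dist_real_def)
qed

text \<open>Averaging over the frequencies \<open>u + 1\<close> and \<open>u - 1\<close> multiplies
  \<open>iexp (u * x)\<close> by \<open>cos x\<close>. So the transform of a law weighted by
  \<open>1 - cos x\<close> can be read off from three values of its characteristic function.\<close>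

lemma second_difference_iexp:
  fixes u x :: real
  shows "iexp (u * x) - (iexp ((u + 1) * x) + iexp ((u - 1) * x)) / 2 = (1 - cos x) *\<^sub>R iexp (u * x)"
proof -
  have "iexp ((u + 1) * x) + iexp ((u - 1) * x) = iexp (u * x) * (iexp x + iexp (- x))"
    by (simp add: algebra_simps exp_add exp_diff exp_minus divide_inverse)
  also have "iexp x + iexp (- x) = 2 * cos x"
    by (simp add: cos_exp_eq flip: cos_of_real)
  finally have "(iexp ((u + 1) * x) + iexp ((u - 1) * x)) / 2 = iexp (u * x) * cos x"
    by simp
  then show ?thesis
    by (simp add: scaleR_conv_of_real algebra_simps)
qed

text \<open>The second difference annihilates the drift and the compensator, so only the
  finite measure \<open>(1 - cos x) \<nu>(dx)\<close> remains.\<close>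

lemma levy_exponent_second_difference:
  fixes b u :: real
  assumes \<nu>: "levy_measure \<nu>"
  shows "levy_exponent b (\<lambda>_. 0) \<nu> u
      - (levy_exponent b (\<lambda>_. 0) \<nu> (u + 1) + levy_exponent b (\<lambda>_. 0) \<nu> (u - 1)) / 2
    = (CLINT x|\<nu>. (1 - cos x) *\<^sub>R iexp (u * x))"
proof -
  define g where "g u x = iexp (u * x) - 1 - \<i> * of_real (u * x * indicator (cball 0 1) x)" for u x :: real
  have int: "integrable \<nu> (g u)" for u
  proof (rule integrable_levy_measure[OF \<nu>])
    show "g u \<in> borel_measurable borel"
    proof -
      have [measurable]: "cball (0::real) 1 \<in> sets borel" by simp
      show ?thesis unfolding g_def by measurable
    qed
    show "cmod (g u x) \<le> (2 + u\<^sup>2) * min 1 ((norm x)\<^sup>2)" for x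
      using levy_integrand_bound[of u x] by (simp add: g_def)
  qed
  have psi: "levy_exponent b (\<lambda>_. 0) \<nu> u = \<i> * of_real (b * u) + (CLINT x|\<nu>. g u x)" for u
    by (simp add: levy_exponent_def g_def)
  have "(CLINT x|\<nu>. g u x) - ((CLINT x|\<nu>. g (u + 1) x) + (CLINT x|\<nu>. g (u - 1) x)) / 2
      = (CLINT x|\<nu>. g u x - (g (u + 1) x + g (u - 1) x) / 2)"
    using int by simp
  also have "\<dots> = (CLINT x|\<nu>. (1 - cos x) *\<^sub>R iexp (u * x))"
  proof (rule Bochner_Integration.integral_cong)
    fix x
    have "g u x - (g (u + 1) x + g (u - 1) x) / 2
        = iexp (u * x) - (iexp ((u + 1) * x) + iexp ((u - 1) * x)) / 2"
      by (simp add: g_def field_simps)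
    then show "g u x - (g (u + 1) x + g (u - 1) x) / 2 = (1 - cos x) *\<^sub>R iexp (u * x)"
      by (simp only: second_difference_iexp)
  qed simp
  finally show ?thesis
    by (simp add: psi field_simps)
qed

section \<open>Weak convergence of the weighted small-time laws\<close>

text \<open>The weight \<open>1 - cos x\<close> is bounded and of order \<open>x\<^sup>2\<close> at
  0, so it suits both probability laws and infinite Levy measures. Normalising yields probability
  measures, to which Levy's continuity theorem applies.\<close>

definition cosine_tilt :: "real measure \<Rightarrow> real measure" where
  "cosine_tilt K = density K (\<lambda>x. ennreal ((1 - cos x) / (LINT y|K. 1 - cos y)))"

text \<open>If the normaliser is 0, the convention for division by zero makes both sides 0.\<close>

lemma integral_cosine_tilt:
  fixes f :: "real \<Rightarrow> 'b::{banach, second_countable_topology}"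
  assumes [measurable_cong]: "sets K = sets borel" and [measurable]: "f \<in> borel_measurable borel"
  shows "integral\<^sup>L (cosine_tilt K) f = (LINT x|K. (1 - cos x) *\<^sub>R f x) /\<^sub>R (LINT x|K. 1 - cos x)"
proof -
  have "integral\<^sup>L (cosine_tilt K) f = (LINT x|K. ((1 - cos x) / (LINT y|K. 1 - cos y)) *\<^sub>R f x)"
    unfolding cosine_tilt_def
    by (intro integral_density) (auto intro!: divide_nonneg_nonneg integral_nonneg_AE)
  also have "\<dots> = (LINT x|K. (1 / (LINT y|K. 1 - cos y)) *\<^sub>R ((1 - cos x) *\<^sub>R f x))"
    by simp
  also have "\<dots> = (LINT x|K. (1 - cos x) *\<^sub>R f x) /\<^sub>R (LINT x|K. 1 - cos x)"
    by (subst integral_scaleR_right) (simp add: inverse_eq_divide)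
  finally show ?thesis .
qed

lemma real_distribution_cosine_tilt:
  assumes [measurable_cong, simp]: "sets K = sets borel" and int: "integrable K (\<lambda>x. 1 - cos x)"
    and pos: "0 < (LINT x|K. 1 - cos x)"
  shows "real_distribution (cosine_tilt K)"
proof -
  let ?Z = "LINT x|K. 1 - cos x"
  have [simp]: "space K = UNIV"
    using sets_eq_imp_space_eq[OF assms(1)] by simp
  have "emeasure (cosine_tilt K) (space (cosine_tilt K)) = (\<integral>\<^sup>+ x. ennreal ((1 - cos x) / ?Z) \<partial>K)"
    unfolding cosine_tilt_def by (subst emeasure_density) (auto intro!: nn_integral_cong)
  also have "\<dots> = ennreal (LINT x|K. (1 - cos x) / ?Z)"
    using int pos by (intro nn_integral_eq_integral) auto
  also have "(LINT x|K. (1 - cos x) / ?Z) = 1"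
    using pos by simp
  finally have "prob_space (cosine_tilt K)"
    by (intro prob_spaceI) simp
  then show ?thesis
    by (simp add: real_distribution_def real_distribution_axioms_def cosine_tilt_def)
qed

text \<open>This is the derivative of \<open>exp\<close> at 0. With \<open>w\<close> equal to
  \<open>t\<close> times the exponent, it turns characteristic functions at time
  \<open>t / Suc n\<close> into the exponent itself.\<close>

lemma tendsto_scaled_exp_minus_one:
  fixes w :: complex
  shows "(\<lambda>n. of_nat (Suc n) * (exp (w / of_nat (Suc n)) - 1)) \<longlonglongrightarrow> w"
proof (cases "w = 0")
  case False
  have "(\<lambda>n. w / of_nat (Suc n)) \<longlonglongrightarrow> 0"
    using LIMSEQ_Suc[OF lim_const_over_n[of w]] by simp
  then have "filterlim (\<lambda>n. w / of_nat (Suc n)) (at 0) sequentially"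
    using False by (auto simp: filterlim_at simp del: of_nat_Suc)
  then have "(\<lambda>n. (exp (w / of_nat (Suc n)) - 1) / (w / of_nat (Suc n))) \<longlonglongrightarrow> 1"
    by (rule filterlim_compose[OF lim_exp_minus_1])
  then have "(\<lambda>n. w * ((exp (w / of_nat (Suc n)) - 1) / (w / of_nat (Suc n)))) \<longlonglongrightarrow> w * 1"
    by (intro tendsto_intros)
  moreover have "w * ((exp (w / of_nat (Suc n)) - 1) / (w / of_nat (Suc n)))
      = of_nat (Suc n) * (exp (w / of_nat (Suc n)) - 1)" for n
    using False by (simp del: of_nat_Suc)
  ultimately show ?thesis
    by simp
qed simp

text \<open>The tilted laws of \<open>X (t / Suc n)\<close> converge weakly to the tilt of
  \<open>\<nu>\<close>. Testing with a bump supported on the interval gives a positive limit, so the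
  interval is charged eventually. It avoids 0 and stays within (-1, 1), where
  \<open>1 - cos x\<close> vanishes only at 0.\<close>

lemma small_time_charges_interval:
  fixes X :: "real \<Rightarrow> 'w \<Rightarrow> real"
  assumes X: "levy_process M X" and triplet: "has_characteristic_triplet M X \<beta> (\<lambda>_. 0) \<nu>"
    and t: "0 < t" and ab: "{a<..<b} \<subseteq> {-1<..<1} - {0}" and charged: "0 < emeasure \<nu> {a<..<b}"
  shows "\<forall>\<^sub>F n in sequentially. 0 < emeasure (distr M borel (X (t / of_nat (Suc n)))) {a<..<b}"
proof -
  note [simp del] = of_nat_Suc
  interpret prob_space M using X by (simp add: levy_process_def)
  have rv: "X s \<in> borel_measurable M" if "0 \<le> s" for s
    using X that by (simp add: levy_process_def)
  have \<nu>: "levy_measure \<nu>"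
    using triplet by (simp add: has_characteristic_triplet_def)
  then have [simp, measurable_cong]: "sets \<nu> = sets borel"
    by (simp add: levy_measure_def)
  then have [simp]: "space \<nu> = UNIV"
    using sets_eq_imp_space_eq by fastforce
  define K where "K n = distr M borel (X (t / of_nat (Suc n)))" for n
  have rvn [measurable]: "X (t / of_nat (Suc n)) \<in> borel_measurable M" for n
    using t by (intro rv) auto
  have [simp, measurable_cong]: "sets (K n) = sets borel" and [simp]: "space (K n) = UNIV" for n
    by (simp_all add: K_def)
  have K: "prob_space (K n)" for n
    unfolding K_def by (intro prob_space_distr) simp
  define \<psi> where "\<psi> = levy_exponent \<beta> (\<lambda>_. 0) \<nu>"
  have char_K: "(CLINT x|K n. iexp (u * x)) = exp (of_real t * \<psi> u / of_nat (Suc n))" for n u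
  proof -
    have "(CLINT x|K n. iexp (u * x)) = (CLINT \<omega>|M. iexp (u \<bullet> X (t / of_nat (Suc n)) \<omega>))"
      unfolding K_def by (subst integral_distr) auto
    also have "\<dots> = exp (of_real (t / of_nat (Suc n)) * \<psi> u)"
      using triplet t unfolding has_characteristic_triplet_def \<psi>_def by auto
    finally show ?thesis by simp
  qed
  \<comment> \<open>\<open>J\<close> is the Fourier transform of the measure with weight
    \<open>1 - cos x\<close>, and \<open>Z\<close> is its total mass.\<close>
  define J where "J \<mu> u = (CLINT x|\<mu>. (1 - cos x) *\<^sub>R iexp (u * x))" for \<mu> and u :: real
  define Z where "Z \<mu> = (LINT x|\<mu>. 1 - cos x)" for \<mu> :: "real measure"
  have J_0: "J \<mu> 0 = of_real (Z \<mu>)" for \<mu>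
    unfolding J_def Z_def by (simp add: scaleR_conv_of_real flip: integral_complex_of_real)
  have J_K: "J (K n) u = (CLINT x|K n. iexp (u * x))
      - ((CLINT x|K n. iexp ((u + 1) * x)) + (CLINT x|K n. iexp ((u - 1) * x))) / 2" for n u
  proof -
    interpret K: prob_space "K n" by (rule K)
    have int: "integrable (K n) (\<lambda>x. iexp (v * x))" for v
      by (rule K.integrable_const_bound[where B=1]) auto
    have "(1 - cos x) *\<^sub>R iexp (u * x)
        = iexp (u * x) - (iexp ((u + 1) * x) + iexp ((u - 1) * x)) / 2" for x
      by (rule second_difference_iexp[symmetric])
    then show ?thesis
      unfolding J_def using int[of u] int[of "u + 1"] int[of "u - 1"] by simp
  qed
  \<comment> \<open>The second difference of the constant 1 is 0, so each characteristic function
    may be replaced by its difference from 1. Scaled by \<open>Suc n\<close>, that difference is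
    \<open>E\<close>.\<close>
  have J_lim: "(\<lambda>n. of_nat (Suc n) * J (K n) u) \<longlonglongrightarrow> of_real t * J \<nu> u" for u
  proof -
    define E where "E v n = of_nat (Suc n) * (exp (of_real t * \<psi> v / of_nat (Suc n)) - 1)" for v n
    have E: "E v \<longlonglongrightarrow> of_real t * \<psi> v" for v
      unfolding E_def by (rule tendsto_scaled_exp_minus_one)
    have "of_nat (Suc n) * J (K n) u = E u n - (E (u + 1) n + E (u - 1) n) / 2" for n
      unfolding J_K char_K E_def by (simp add: field_simps del: of_nat_Suc)
    moreover have "(\<lambda>n. E u n - (E (u + 1) n + E (u - 1) n) / 2)
        \<longlonglongrightarrow> of_real t * \<psi> u - (of_real t * \<psi> (u + 1) + of_real t * \<psi> (u - 1)) / 2"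
      by (intro tendsto_intros E) simp
    moreover have "of_real t * \<psi> u - (of_real t * \<psi> (u + 1) + of_real t * \<psi> (u - 1)) / 2
        = of_real t * J \<nu> u"
      unfolding J_def \<psi>_def levy_exponent_second_difference[OF \<nu>, symmetric, of _ \<beta>]
      by (simp add: field_simps)
    ultimately show ?thesis by simp
  qed
  have Z_lim: "(\<lambda>n. of_nat (Suc n) * Z (K n)) \<longlonglongrightarrow> t * Z \<nu>"
    using tendsto_Re[OF J_lim[of 0]] by (simp add: J_0)
  have weight_pos: "0 < 1 - cos x" if "x \<in> {a<..<b}" for x
  proof -
    have "x \<in> {-1<..<1} - {0}"
      using that ab by blast
    then have "cos \<bar>x\<bar> < cos 0"
      using pi_gt3 by (intro cos_monotone_0_pi) auto
    then show ?thesis by simp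
  qed
  have integrable_weight: "integrable \<mu> (\<lambda>x. (1 - cos x) *\<^sub>R f x)"
    if "levy_measure \<mu>" "f \<in> borel_measurable borel" "\<And>x. \<bar>f x\<bar> \<le> C" for \<mu> C and f :: "real \<Rightarrow> real"
  proof (rule integrable_levy_measure[OF that(1)])
    show "norm ((1 - cos x) *\<^sub>R f x) \<le> (2 * C) * min 1 ((norm x)\<^sup>2)" for x
      using mult_mono[OF one_minus_cos_le that(3), of x x] by (simp add: abs_mult mult_ac)
  qed (use that(2) in simp)
  \<comment> \<open>Used twice: \<open>f = 1\<close> shows that the normaliser of
    \<open>\<nu>\<close> is positive, and the bump \<open>g\<close> below gives a positive
    limit.\<close>
  have integral_pos: "0 < (LINT x|\<nu>. (1 - cos x) *\<^sub>R f x)"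
    if f: "f \<in> borel_measurable borel" "\<And>x. \<bar>f x\<bar> \<le> C" "\<And>x. 0 \<le> f x"
      "\<And>x. x \<in> {a<..<b} \<Longrightarrow> 0 < f x" for f :: "real \<Rightarrow> real" and C
  proof (rule ccontr)
    assume neg: "\<not> ?thesis"
    have int: "integrable \<nu> (\<lambda>x. (1 - cos x) *\<^sub>R f x)"
      by (rule integrable_weight[OF \<nu> f(1,2)])
    have "0 \<le> (LINT x|\<nu>. (1 - cos x) *\<^sub>R f x)"
      using f(3) by (intro integral_nonneg_AE) auto
    with neg have "(LINT x|\<nu>. (1 - cos x) *\<^sub>R f x) = 0"
      by linarith
    then have "AE x in \<nu>. (1 - cos x) *\<^sub>R f x = 0"
      using f(3) by (subst (asm) integral_nonneg_eq_0_iff_AE[OF int]) auto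
    then have "AE x in \<nu>. x \<notin> {a<..<b}"
      by (rule AE_mp) (use weight_pos f(4) in \<open>fastforce intro!: AE_I2\<close>)
    then have "emeasure \<nu> {a<..<b} = 0"
      by (subst (asm) AE_iff_measurable[of "{a<..<b}"]) auto
    with charged show False by simp
  qed
  have Z_pos: "0 < Z \<nu>"
    using integral_pos[of "\<lambda>_. 1" 1] by (simp add: Z_def)
  have dist_\<nu>: "real_distribution (cosine_tilt \<nu>)"
    using Z_pos integrable_weight[OF \<nu>, of "\<lambda>_. 1" 1]
    by (intro real_distribution_cosine_tilt) (auto simp: Z_def)
  have "\<forall>\<^sub>F n in sequentially. 0 < of_nat (Suc n) * Z (K n)"
    using order_tendstoD(1)[OF Z_lim, of 0] t Z_pos by simp
  \<comment> \<open>\<open>Z (K n)\<close> is only known to be positive for large \<open>n\<close>;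
    shifting the index by \<open>N\<close> leaves probability measures throughout.\<close>
  then obtain N where N: "\<And>n. N \<le> n \<Longrightarrow> 0 < Z (K n)"
    by (auto simp: eventually_sequentially zero_less_mult_iff)
  have dist_K: "real_distribution (cosine_tilt (K (n + N)))" for n
  proof -
    interpret K: prob_space "K (n + N)" by (rule K)
    have "integrable (K (n + N)) (\<lambda>x. 1 - cos x)"
      by (rule K.integrable_const_bound[where B=2])
         (auto intro!: AE_I2 intro: order_trans[OF abs_triangle_ineq4])
    then show ?thesis
      using N[of "n + N"] by (intro real_distribution_cosine_tilt) (auto simp: Z_def)
  qed
  have char_tilt: "char (cosine_tilt \<mu>) u = J \<mu> u / of_real (Z \<mu>)" if "sets \<mu> = sets borel" for \<mu> u
    using that unfolding char_def
    by (subst integral_cosine_tilt) (auto simp: J_def Z_def scaleR_conv_of_real divide_inverse mult.commute)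
  have "weak_conv_m (\<lambda>n. cosine_tilt (K (n + N))) (cosine_tilt \<nu>)"
  proof (rule levy_continuity[OF dist_K dist_\<nu>])
    fix u
    \<comment> \<open>The factor \<open>Suc n\<close> cancels in the quotient, as does
      \<open>t\<close> in the limit, leaving the characteristic functions of the tilts.\<close>
    have "(\<lambda>n. (of_nat (Suc n) * J (K n) u) / of_real (of_nat (Suc n) * Z (K n)))
        \<longlonglongrightarrow> (of_real t * J \<nu> u) / of_real (t * Z \<nu>)"
      using t Z_pos by (intro tendsto_divide J_lim tendsto_of_real Z_lim) simp
    moreover have "(of_nat (Suc n) * J (K n) u) / of_real (of_nat (Suc n) * Z (K n))
        = char (cosine_tilt (K n)) u" for n
      by (simp add: char_tilt del: of_nat_Suc)
    moreover have "(of_real t * J \<nu> u) / of_real (t * Z \<nu>) = char (cosine_tilt \<nu>) u"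
      using t by (simp add: char_tilt)
    ultimately have "(\<lambda>n. char (cosine_tilt (K n)) u) \<longlonglongrightarrow> char (cosine_tilt \<nu>) u"
      by simp
    then show "(\<lambda>n. char (cosine_tilt (K (n + N))) u) \<longlonglongrightarrow> char (cosine_tilt \<nu>) u"
      by (rule LIMSEQ_ignore_initial_segment)
  qed
  \<comment> \<open>A tent function: continuous and bounded, positive exactly on the open
    interval.\<close>
  moreover define g where "g x = max 0 (min (x - a) (b - x))" for x
  have g_bound: "\<bar>g x\<bar> \<le> \<bar>b - a\<bar>" for x
    by (auto simp: g_def)
  have g_cont: "isCont g x" for x
    unfolding g_def by (intro continuous_intros)
  have g_meas: "g \<in> borel_measurable borel"
    unfolding g_def by measurable
  ultimately have lim: "(\<lambda>n. integral\<^sup>L (cosine_tilt (K (n + N))) g) \<longlonglongrightarrow> integral\<^sup>L (cosine_tilt \<nu>) g"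
    using dist_K dist_\<nu> g_cont g_bound
    by (intro weak_conv_imp_integral_bdd_continuous_conv[where B="\<bar>b - a\<bar>"]) auto
  have "0 < integral\<^sup>L (cosine_tilt \<nu>) g"
    using integral_pos[of g "\<bar>b - a\<bar>"] Z_pos g_meas g_bound
    by (subst integral_cosine_tilt) (auto simp: Z_def g_def)
  then have "\<forall>\<^sub>F n in sequentially. 0 < integral\<^sup>L (cosine_tilt (K (n + N))) g"
    by (rule order_tendstoD(1)[OF lim])
  then have "\<forall>\<^sub>F n in sequentially. 0 < integral\<^sup>L (cosine_tilt (K n)) g"
    by (subst (asm) eventually_sequentially_seg)
  then show ?thesis
  proof (rule eventually_mono)
    fix n assume pos: "0 < integral\<^sup>L (cosine_tilt (K n)) g"
    show "0 < emeasure (distr M borel (X (t / of_nat (Suc n)))) {a<..<b}"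
      unfolding K_def[symmetric]
    proof (rule ccontr)
      assume "\<not> 0 < emeasure (K n) {a<..<b}"
      then have "AE x in K n. x \<notin> {a<..<b}"
        by (subst AE_iff_measurable[of "{a<..<b}"]) auto
      then have "AE x in K n. (1 - cos x) *\<^sub>R g x = 0"
        by (rule AE_mp) (auto simp: g_def)
      then have "(LINT x|K n. (1 - cos x) *\<^sub>R g x) = 0"
        by (rule integral_eq_zero_AE)
      then have "integral\<^sup>L (cosine_tilt (K n)) g = 0"
        using g_meas by (subst integral_cosine_tilt) auto
      with pos show False by simp
    qed
  qed
qed

section \<open>Full support of a Levy process at positive times\<close>

lemma measure_support_distrD:
  assumes "X \<in> borel_measurable M" "x \<in> measure_support (distr M borel X)" "open U" "x \<in> U"
  shows "0 < emeasure M {\<omega> \<in> space M. X \<omega> \<in> U}"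
  using assms by (auto simp: measure_support_def emeasure_distr vimage_def Int_def conj_commute)

text \<open>Given neighbourhoods \<open>A\<close> of \<open>x\<close> and \<open>B\<close> of
  \<open>y\<close> with all sums in \<open>U\<close>, the increments over the two successive time
  spans fall into \<open>A\<close> and \<open>B\<close> with positive probability each. By
  independence they do so jointly.\<close>

lemma measure_support_levy_add:
  fixes X :: "real \<Rightarrow> 'w \<Rightarrow> 'a::euclidean_space"
  assumes X: "levy_process M X" and s: "0 \<le> s" and t: "0 \<le> t"
    and x: "x \<in> measure_support (distr M borel (X s))"
    and y: "y \<in> measure_support (distr M borel (X t))"
  shows "x + y \<in> measure_support (distr M borel (X (s + t)))"
proof -
  interpret prob_space M using X by (simp add: levy_process_def)
  have rv: "X u \<in> borel_measurable M" if "0 \<le> u" for u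
    using X that by (simp add: levy_process_def)
  have [measurable]: "X 0 \<in> borel_measurable M" "X s \<in> borel_measurable M" "X t \<in> borel_measurable M"
    "X (s + t) \<in> borel_measurable M"
    using s t by (auto intro: rv)
  have X0: "AE \<omega> in M. X 0 \<omega> = 0"
    using X by (simp add: levy_process_def)
  have stationary: "distr M borel (\<lambda>\<omega>. X (u + v) \<omega> - X u \<omega>) = distr M borel (X v)"
    if "0 \<le> u" "0 \<le> v" for u v
    using X that by (simp add: levy_process_def)
  \<comment> \<open>The time sequence is continued by the constant \<open>s + t\<close>, since
    \<open>levy_process\<close> asks for a monotone sequence on all of \<open>nat\<close>; only its
    first two increments matter.\<close>
  define \<tau> where "\<tau> k = (if k = 0 then 0 else if k = 1 then s else s + t)" for k :: nat
  define D where "D k \<omega> = X (\<tau> (Suc k)) \<omega> - X (\<tau> k) \<omega>" for k \<omega>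
  have "mono \<tau>"
    using s t by (auto simp: \<tau>_def mono_def)
  moreover have "0 \<le> \<tau> 0"
    by (simp add: \<tau>_def)
  ultimately have indep: "indep_vars (\<lambda>_. borel) D {..<2}"
    using X unfolding levy_process_def D_def by blast
  have D_meas: "D 0 \<in> borel_measurable M" "D 1 \<in> borel_measurable M"
    unfolding D_def \<tau>_def by simp_all
  have D0: "x \<in> measure_support (distr M borel (D 0))"
    using x stationary[of 0 s] s unfolding D_def \<tau>_def by simp
  have D1: "y \<in> measure_support (distr M borel (D 1))"
    using y stationary[of s t] s t unfolding D_def \<tau>_def by simp
  show ?thesis
    unfolding measure_support_def
  proof (intro CollectI allI impI, elim conjE)
    fix U :: "'a set" assume U: "open U" "x + y \<in> U"
    have "open ((\<lambda>z. fst z + snd z) -` U)"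
      by (intro continuous_open_vimage U continuous_intros)
    then obtain A B where AB: "open A" "open B" "x \<in> A" "y \<in> B"
      and AB_U: "A \<times> B \<subseteq> (\<lambda>z. fst z + snd z) -` U"
      using U(2) by (elim open_prod_elim[where x="(x, y)"]) auto
    define F where "F k = (if k = 0 then A else B)" for k :: nat
    have "prob (\<Inter>k\<in>{..<2}. D k -` F k \<inter> space M) = (\<Prod>k\<in>{..<2}. prob (D k -` F k \<inter> space M))"
      using AB by (intro indep_varsD_finite[OF indep]) (auto simp: F_def lessThan_empty_iff)
    also have "\<dots> = prob (D 0 -` A \<inter> space M) * prob (D 1 -` B \<inter> space M)"
      by (simp add: F_def numeral_2_eq_2)
    also have "\<dots> > 0"
      using measure_support_distrD[OF D_meas(1) D0 AB(1,3)] measure_support_distrD[OF D_meas(2) D1 AB(2,4)]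
      by (simp add: emeasure_eq_measure vimage_def Int_def conj_commute)
    finally have pos: "0 < emeasure M (\<Inter>k\<in>{..<2}. D k -` F k \<inter> space M)"
      by (simp add: emeasure_eq_measure)
    \<comment> \<open>The inclusion holds only almost surely: the increments add up to
      \<open>X (s + t) - X 0\<close>, and \<open>X 0\<close> is 0 almost surely.\<close>
    have "emeasure M (\<Inter>k\<in>{..<2}. D k -` F k \<inter> space M) \<le> emeasure M (X (s + t) -` U \<inter> space M)"
    proof (rule emeasure_mono_AE)
      show "AE \<omega> in M. \<omega> \<in> (\<Inter>k\<in>{..<2}. D k -` F k \<inter> space M) \<longrightarrow> \<omega> \<in> X (s + t) -` U \<inter> space M"
        using X0
      proof (rule AE_mp, intro AE_I2 impI)
        fix \<omega> assume \<omega>: "X 0 \<omega> = 0" "\<omega> \<in> (\<Inter>k\<in>{..<2}. D k -` F k \<inter> space M)" "\<omega> \<in> space M"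
        have "D 0 \<omega> \<in> A" "D 1 \<omega> \<in> B"
          using \<omega>(2) by (auto simp: F_def numeral_2_eq_2 lessThan_Suc)
        then have "D 0 \<omega> + D 1 \<omega> \<in> U"
          using AB_U by (auto simp: subset_eq)
        moreover have "D 0 \<omega> + D 1 \<omega> = X (s + t) \<omega>"
          using \<omega>(1) by (simp add: D_def \<tau>_def)
        ultimately show "\<omega> \<in> X (s + t) -` U \<inter> space M"
          using \<omega>(3) by simp
      qed
      show "X (s + t) -` U \<inter> space M \<in> sets M"
        using U(1) by measurable
    qed
    with pos have "0 < emeasure M (X (s + t) -` U \<inter> space M)"
      by simp
    then show "0 < emeasure (distr M borel (X (s + t))) U"
      using U(1) by (simp add: emeasure_distr)
  qed
qed

lemma measure_support_levy_zero:
  fixes X :: "real \<Rightarrow> 'w \<Rightarrow> 'a::euclidean_space"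
  assumes X: "levy_process M X"
  shows "0 \<in> measure_support (distr M borel (X 0))"
proof -
  interpret prob_space M using X by (simp add: levy_process_def)
  have [measurable]: "X 0 \<in> borel_measurable M" and X0: "AE \<omega> in M. X 0 \<omega> = 0"
    using X by (simp_all add: levy_process_def)
  show ?thesis
    unfolding measure_support_def
  proof (intro CollectI allI impI, elim conjE)
    fix U :: "'a set" assume U: "open U" "0 \<in> U"
    have "emeasure M (X 0 -` U \<inter> space M) = 1"
    proof (rule emeasure_eq_1_AE)
      show "AE \<omega> in M. \<omega> \<in> X 0 -` U \<inter> space M"
        using X0 by (rule AE_mp) (use U in auto)
    qed (use U in measurable)
    then show "0 < emeasure (distr M borel (X 0)) U"
      using U by (simp add: emeasure_distr)
  qed
qed

lemma measure_support_levy_scaleR_of_nat: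
  fixes X :: "real \<Rightarrow> 'w \<Rightarrow> 'a::euclidean_space"
  assumes X: "levy_process M X" and s: "0 \<le> s" and x: "x \<in> measure_support (distr M borel (X s))"
  shows "of_nat k *\<^sub>R x \<in> measure_support (distr M borel (X (of_nat k * s)))"
proof (induction k)
  case 0
  then show ?case using measure_support_levy_zero[OF X] by simp
next
  case (Suc k)
  then show ?case
    using measure_support_levy_add[OF X _ _ x Suc, OF s] s by (simp add: algebra_simps)
qed

text \<open>Replacing one \<open>q\<close> by a \<open>p\<close> raises the sum by
  \<open>p - q\<close>, so the sums form a grid of that mesh from \<open>n * q\<close> to
  \<open>n * p\<close>.\<close>

lemma between_multiples:
  fixes p q x :: real
  assumes "q < p" "real n * q \<le> x" "x \<le> real n * p"
  shows "\<exists>k\<le>n. \<bar>real k * p + real (n - k) * q - x\<bar> \<le> p - q"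
proof (cases "n = 0")
  case False
  define r where "r = (x - real n * q) / (p - q)"
  have x: "x = real n * q + r * (p - q)"
    using assms by (simp add: r_def)
  have r: "0 \<le> r" "r \<le> real n"
    using assms by (auto simp: r_def field_simps)
  define k where "k = nat \<lfloor>r\<rfloor>"
  have k: "real k \<le> r" "r < real k + 1"
    using r by (auto simp: k_def)
  then have "k \<le> n"
    using r by linarith
  have "real k * p + real (n - k) * q - x = - ((r - real k) * (p - q))"
    using \<open>k \<le> n\<close> by (simp add: x of_nat_diff algebra_simps)
  then have "\<bar>real k * p + real (n - k) * q - x\<bar> = (r - real k) * (p - q)"
    using k(1) assms(1) by simp
  also have "\<dots> \<le> 1 * (p - q)"
    using k assms(1) by (intro mult_right_mono) auto
  finally show ?thesis
    using \<open>k \<le> n\<close> by auto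
qed (use assms in auto)

text \<open>Continuity from below along the intervals from \<open>1 / Suc n\<close> to
  \<open>e\<close>. The resulting \<open>a\<close> bounds the steps of the grid away from 0,
  uniformly in the number of steps.\<close>

lemma emeasure_subinterval_pos:
  fixes \<mu> :: "real measure"
  assumes [simp]: "sets \<mu> = sets borel" and pos: "0 < emeasure \<mu> {0<..<e}"
  shows "\<exists>a>0. 0 < emeasure \<mu> {a<..<e}"
proof (rule ccontr)
  assume contra: "\<not> ?thesis"
  have "{0<..<e} \<subseteq> (\<Union>n. {inverse (real (Suc n))<..<e})"
    using reals_Archimedean by fastforce
  then have "emeasure \<mu> {0<..<e} \<le> emeasure \<mu> (\<Union>n. {inverse (real (Suc n))<..<e})"
    by (intro emeasure_mono) auto
  also have "\<dots> = 0"
    using contra by (intro emeasure_UN_eq_0) auto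
  finally show False
    using pos by simp
qed

lemma measure_support_levy_UNIV:
  fixes X :: "real \<Rightarrow> 'w \<Rightarrow> real"
  assumes X: "levy_process M X" and triplet: "has_characteristic_triplet M X \<beta> (\<lambda>_. 0) \<nu>"
    and neg: "\<And>e. 0 < e \<Longrightarrow> 0 < emeasure \<nu> {-e<..<0}"
    and pos: "\<And>e. 0 < e \<Longrightarrow> 0 < emeasure \<nu> {0<..<e}"
    and t: "0 < t"
  shows "measure_support (distr M borel (X t)) = UNIV"
proof (rule UNIV_eq_I[symmetric])
  fix x
  have [simp, measurable_cong]: "sets \<nu> = sets borel"
    using triplet by (simp add: has_characteristic_triplet_def levy_measure_def)
  show "x \<in> measure_support (distr M borel (X t))"
    unfolding measure_support_def
  proof (intro CollectI allI impI, elim conjE)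
    fix U assume U: "open U" "x \<in> U"
    then obtain \<eta> where \<eta>: "0 < \<eta>" "ball x \<eta> \<subseteq> U"
      using openE by blast
    \<comment> \<open>The mesh \<open>p - q\<close> will be below \<open>2 * e\<close>, hence below
      \<open>\<eta>\<close>; the bound 1 keeps the intervals within (-1, 1).\<close>
    define e where "e = min 1 (\<eta> / 4)"
    have e: "0 < e" "e \<le> 1" "2 * e < \<eta>"
      using \<eta> by (auto simp: e_def min_def)
    obtain a where a: "0 < a" "0 < emeasure \<nu> {a<..<e}"
      using emeasure_subinterval_pos[OF _ pos[OF e(1)]] by auto
    \<comment> \<open>The negative half-line is reduced to the positive one by reflecting
      \<open>\<nu>\<close>.\<close>
    have "0 < emeasure (distr \<nu> borel uminus) {0<..<e}"
    proof -
      have "uminus -` {0<..<e} = {-e<..<0::real}" by auto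
      then show ?thesis
        using neg[OF e(1)] sets_eq_imp_space_eq[of \<nu> borel] by (subst emeasure_distr) auto
    qed
    then obtain a' where a': "0 < a'" "0 < emeasure (distr \<nu> borel uminus) {a'<..<e}"
      using emeasure_subinterval_pos[of "distr \<nu> borel uminus"] by auto
    have "uminus -` {a'<..<e} = {-e<..<-a'::real}" by auto
    then have neg': "0 < emeasure \<nu> {-e<..<-a'}"
      using a'(2) sets_eq_imp_space_eq[of \<nu> borel] by (subst (asm) emeasure_distr) auto
    have "\<forall>\<^sub>F n in sequentially. 0 < emeasure (distr M borel (X (t / of_nat (Suc n)))) {a<..<e}"
      using e a by (intro small_time_charges_interval[OF X triplet t]) auto
    moreover have "\<forall>\<^sub>F n in sequentially. 0 < emeasure (distr M borel (X (t / of_nat (Suc n)))) {-e<..<-a'}"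
      using e a' neg' by (intro small_time_charges_interval[OF X triplet t]) auto
    \<comment> \<open>Enough steps for the range of the grid to reach \<open>x\<close> on either
      side.\<close>
    moreover have "\<forall>\<^sub>F n in sequentially. \<bar>x\<bar> / min a a' \<le> real (Suc n)"
      using filterlim_compose[OF filterlim_real_sequentially filterlim_Suc]
      by (simp add: filterlim_at_top)
    ultimately have "\<forall>\<^sub>F n in sequentially. 0 < emeasure (distr M borel (X (t / of_nat (Suc n)))) {a<..<e} \<and>
      0 < emeasure (distr M borel (X (t / of_nat (Suc n)))) {-e<..<-a'} \<and> \<bar>x\<bar> / min a a' \<le> real (Suc n)"
      by eventually_elim auto
    then obtain n where n: "0 < emeasure (distr M borel (X (t / of_nat (Suc n)))) {a<..<e}"
      "0 < emeasure (distr M borel (X (t / of_nat (Suc n)))) {-e<..<-a'}"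
      "\<bar>x\<bar> / min a a' \<le> real (Suc n)"
      by (auto dest: eventually_happens)
    define m where "m = Suc n"
    have m: "\<bar>x\<bar> \<le> real m * a" "\<bar>x\<bar> \<le> real m * a'"
      using n(3) a(1) a'(1) mult_left_mono[of "min a a'" a "real m"] mult_left_mono[of "min a a'" a' "real m"]
      by (auto simp: pos_divide_le_eq m_def[symmetric])
    obtain p where p: "a < p" "p < e" "p \<in> measure_support (distr M borel (X (t / of_nat m)))"
      using measure_support_meets[OF _ _ n(1)] by (auto simp: m_def)
    obtain q where q: "-e < q" "q < -a'" "q \<in> measure_support (distr M borel (X (t / of_nat m)))"
      using measure_support_meets[OF _ _ n(2)] by (auto simp: m_def)
    have "real m * q \<le> real m * (- a')"
      using q(2) by (intro mult_left_mono) auto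
    moreover have "real m * a \<le> real m * p"
      using p(1) by (intro mult_left_mono) auto
    ultimately have "real m * q \<le> x" "x \<le> real m * p"
      using m by simp_all
    moreover have "q < p"
      using p(1) q(2) a(1) a'(1) by linarith
    ultimately obtain k where k: "k \<le> m" "\<bar>real k * p + real (m - k) * q - x\<bar> \<le> p - q"
      using between_multiples by blast
    have "of_nat k *\<^sub>R p + of_nat (m - k) *\<^sub>R q
        \<in> measure_support (distr M borel (X (of_nat k * (t / of_nat m) + of_nat (m - k) * (t / of_nat m))))"
      using t p q by (intro measure_support_levy_add[OF X] measure_support_levy_scaleR_of_nat[OF X]) auto
    also have "of_nat k * (t / of_nat m) + of_nat (m - k) * (t / of_nat m) = (real k + real (m - k)) * (t / real m)"
      by (simp only: distrib_right)
    also have "real k + real (m - k) = real m"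
      using k(1) by simp
    also have "real m * (t / real m) = t"
      by (simp add: m_def)
    finally have "real k * p + real (m - k) * q \<in> measure_support (distr M borel (X t))"
      by simp
    moreover have "real k * p + real (m - k) * q \<in> U"
    proof -
      have "\<bar>real k * p + real (m - k) * q - x\<bar> < \<eta>"
        using k(2) p(2) q(1) e(3) by linarith
      then show ?thesis
        using \<eta>(2) by (auto simp: dist_real_def abs_minus_commute)
    qed
    ultimately show "0 < emeasure (distr M borel (X t)) U"
      using U(1) by (auto simp: measure_support_def)
  qed
qed

section \<open>Lower bounds locally uniform in the times\<close>

text \<open>By stochastic continuity, for \<open>s\<close> near \<open>t\<close> the event that
  \<open>X s\<close> is more than \<open>e / 2\<close> away from \<open>X t\<close> has less than
  half the probability that \<open>X t\<close> is in the ball of radius \<open>e / 2\<close>. At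
  least the other half remains.\<close>

lemma levy_locally_uniform_lower_bound:
  fixes X :: "real \<Rightarrow> 'w \<Rightarrow> 'a::euclidean_space"
  assumes X: "levy_process M X" and t: "0 \<le> t" and e: "0 < e"
    and x: "x \<in> measure_support (distr M borel (X t))"
  shows "\<exists>\<kappa>>0. \<exists>\<delta>>0. \<forall>s\<ge>0. \<bar>s - t\<bar> < \<delta> \<longrightarrow> \<kappa> \<le> measure M {\<omega> \<in> space M. X s \<omega> \<in> ball x e}"
proof -
  interpret prob_space M using X by (simp add: levy_process_def)
  have rv: "X s \<in> borel_measurable M" if "0 \<le> s" for s
    using X that by (simp add: levy_process_def)
  note [measurable] = rv[OF t]
  define \<pi> where "\<pi> = prob {\<omega> \<in> space M. X t \<omega> \<in> ball x (e / 2)}"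
  have \<pi>: "0 < \<pi>"
    using measure_support_distrD[OF rv[OF t] x, of "ball x (e / 2)"] e
    by (simp add: \<pi>_def emeasure_eq_measure)
  have "((\<lambda>s. prob {\<omega> \<in> space M. dist (X s \<omega>) (X t \<omega>) > e / 2}) \<longlongrightarrow> 0) (at t within {0..})"
    using X t half_gt_zero[OF e] unfolding levy_process_def by blast
  then have "\<forall>\<^sub>F s in at t within {0..}. prob {\<omega> \<in> space M. dist (X s \<omega>) (X t \<omega>) > e / 2} < \<pi> / 2"
    using \<pi> by (intro order_tendstoD) auto
  then obtain \<delta> where \<delta>: "0 < \<delta>"
    "\<And>s. 0 \<le> s \<Longrightarrow> s \<noteq> t \<Longrightarrow> \<bar>s - t\<bar> < \<delta> \<Longrightarrow>
      prob {\<omega> \<in> space M. dist (X s \<omega>) (X t \<omega>) > e / 2} < \<pi> / 2"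
    by (auto simp: eventually_at dist_real_def)
  have "\<pi> / 2 \<le> prob {\<omega> \<in> space M. X s \<omega> \<in> ball x e}" if s: "0 \<le> s" "\<bar>s - t\<bar> < \<delta>" for s
  proof -
    note [measurable] = rv[OF s(1)]
    have [measurable]: "{\<omega> \<in> space M. X s \<omega> \<in> ball x e} \<in> events"
      unfolding mem_ball by measurable
    \<comment> \<open>The punctured filter says nothing about \<open>s = t\<close>, where the event
      is empty.\<close>
    have small: "prob {\<omega> \<in> space M. dist (X s \<omega>) (X t \<omega>) > e / 2} < \<pi> / 2"
      using \<delta>(2)[OF s(1) _ s(2)] \<pi> e by (cases "s = t") auto
    have "\<pi> \<le> prob ({\<omega> \<in> space M. X s \<omega> \<in> ball x e} \<union> {\<omega> \<in> space M. dist (X s \<omega>) (X t \<omega>) > e / 2})"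
      unfolding \<pi>_def
    proof (rule finite_measure_mono)
      show "{\<omega> \<in> space M. X t \<omega> \<in> ball x (e / 2)}
          \<subseteq> {\<omega> \<in> space M. X s \<omega> \<in> ball x e} \<union> {\<omega> \<in> space M. dist (X s \<omega>) (X t \<omega>) > e / 2}"
      proof
        fix \<omega> assume "\<omega> \<in> {\<omega> \<in> space M. X t \<omega> \<in> ball x (e / 2)}"
        then show "\<omega> \<in> {\<omega> \<in> space M. X s \<omega> \<in> ball x e} \<union> {\<omega> \<in> space M. dist (X s \<omega>) (X t \<omega>) > e / 2}"
          using dist_triangle2[of x "X s \<omega>" "X t \<omega>"] by auto
      qed
    qed measurable
    also have "\<dots> \<le> prob {\<omega> \<in> space M. X s \<omega> \<in> ball x e}
        + prob {\<omega> \<in> space M. dist (X s \<omega>) (X t \<omega>) > e / 2}"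
      by (rule measure_Un_le) measurable
    finally show ?thesis
      using small by linarith
  qed
  with \<pi> \<delta>(1) show ?thesis
    by (intro exI[of _ "\<pi> / 2"] exI[of _ \<delta>] conjI) auto
qed

text \<open>Evaluation at a fixed nonnegative time is measurable on paths, so independence of the
  processes passes to their values at different times.\<close>

lemma prob_multitime_box:
  fixes L :: "'d::finite \<Rightarrow> real \<Rightarrow> 'w \<Rightarrow> real"
  assumes M: "prob_space M" and indep: "indep_processes M L"
    and s: "\<And>i. 0 \<le> s i" and A: "\<And>i. A i \<in> sets borel"
  shows "measure M {\<omega> \<in> space M. \<forall>i. L i (s i) \<omega> \<in> A i}
    = (\<Prod>i\<in>UNIV. measure M {\<omega> \<in> space M. L i (s i) \<omega> \<in> A i})"
proof -
  interpret prob_space M by (rule M)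
  have "indep_vars (\<lambda>_. borel) (\<lambda>i \<omega>. process_path (L i) \<omega> (s i)) UNIV"
    using indep unfolding indep_processes_def
    by (rule indep_vars_compose2) (use s in \<open>auto intro!: measurable_component_singleton\<close>)
  then have "indep_vars (\<lambda>_. borel) (\<lambda>i. L i (s i)) UNIV"
    using s by (simp add: process_path_def)
  from indep_varsD_finite[OF this, of A] A
  show ?thesis
    by (simp add: vimage_def Int_def conj_commute flip: Collect_ball_eq)
qed

text \<open>A constant lower bound near \<open>s\<^sub>0\<close>, rather than mere positivity, avoids having to show that
  \<open>s \<mapsto> \<mu>\<^sub>s B\<close> is measurable when it is integrated against \<open>\<rho>\<close>.\<close>

lemma multitime_law_locally_uniform_lower_bound:
  fixes L :: "'d::finite \<Rightarrow> real \<Rightarrow> 'w \<Rightarrow> real"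
  assumes L: "\<And>i. levy_process M (L i)" and indep: "indep_processes M L"
    and supp: "\<And>i. x $ i \<in> measure_support (distr M borel (L i (s\<^sub>0 $ i)))"
    and s\<^sub>0: "s\<^sub>0 \<in> pos_orthant" and B: "open B" "x \<in> B"
  shows "\<exists>\<kappa>>0. \<exists>U. open U \<and> s\<^sub>0 \<in> U \<and> U \<subseteq> nonneg_orthant \<and>
    (\<forall>s\<in>U. ennreal \<kappa> \<le> emeasure (multitime_law M L s) B)"
proof -
  interpret prob_space M using L by (simp add: levy_process_def)
  have rv: "L i s \<in> borel_measurable M" if "0 \<le> s" for i s
    using L that by (simp add: levy_process_def)
  have s\<^sub>0_pos: "0 < s\<^sub>0 $ i" for i
    using s\<^sub>0 by (simp add: pos_orthant_def)
  obtain A where A: "\<And>i. open (A i)" "\<And>i. x $ i \<in> A i" "\<And>y. (\<And>i. y $ i \<in> A i) \<Longrightarrow> y \<in> B"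
    using B unfolding open_vec_def by metis
  have "\<exists>e>0. ball (x $ i) e \<subseteq> A i" for i
    using A(1,2) openE by metis
  then obtain e where e: "\<And>i. 0 < e i" "\<And>i. ball (x $ i) (e i) \<subseteq> A i"
    by metis
  have "\<exists>\<kappa> \<delta>. 0 < \<kappa> \<and> 0 < \<delta> \<and> (\<forall>s\<ge>0. \<bar>s - s\<^sub>0 $ i\<bar> < \<delta> \<longrightarrow>
      \<kappa> \<le> prob {\<omega> \<in> space M. L i s \<omega> \<in> ball (x $ i) (e i)})" for i
    using levy_locally_uniform_lower_bound[OF L _ e(1) supp] s\<^sub>0_pos[of i] by (metis less_imp_le)
  then obtain \<kappa> \<delta> where \<kappa>: "\<And>i. 0 < \<kappa> i" and \<delta>: "\<And>i. 0 < \<delta> i"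
    and bound: "\<And>i s. 0 \<le> s \<Longrightarrow> \<bar>s - s\<^sub>0 $ i\<bar> < \<delta> i \<Longrightarrow>
      \<kappa> i \<le> prob {\<omega> \<in> space M. L i s \<omega> \<in> ball (x $ i) (e i)}"
    by metis
  \<comment> \<open>Intersecting with the positive half-lines keeps all times in \<open>U\<close>
    admissible; this is possible because \<open>s\<^sub>0\<close> has positive coordinates.\<close>
  define U where "U = {s. \<forall>i. s $ i \<in> ball (s\<^sub>0 $ i) (\<delta> i) \<inter> {0<..}}"
  have "open U"
  proof -
    have "U = (\<Inter>i. (\<lambda>s. s $ i) -` (ball (s\<^sub>0 $ i) (\<delta> i) \<inter> {0<..}))"
      by (auto simp: U_def)
    then show ?thesis
      by (auto intro!: open_INT open_vimage_vec_nth)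
  qed
  moreover have "s\<^sub>0 \<in> U"
    using \<delta> s\<^sub>0_pos by (simp add: U_def)
  moreover have "U \<subseteq> nonneg_orthant"
    by (auto simp: U_def nonneg_orthant_def intro: less_imp_le)
  moreover have "ennreal (\<Prod>i\<in>UNIV. \<kappa> i) \<le> emeasure (multitime_law M L s) B" if "s \<in> U" for s
  proof -
    have s: "0 \<le> s $ i" "\<bar>s $ i - s\<^sub>0 $ i\<bar> < \<delta> i" for i
      using that by (auto simp: U_def dist_real_def abs_minus_commute intro: less_imp_le)
    have [measurable]: "L i (s $ i) \<in> borel_measurable M" for i
      by (rule rv[OF s(1)])
    have meas: "(\<lambda>\<omega>. \<chi> i. L i (s $ i) \<omega>) \<in> borel_measurable M"
      by (subst borel_measurable_euclidean_space)
         (auto simp: Basis_vec_def inner_axis)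
    have "(\<Prod>i\<in>UNIV. \<kappa> i) \<le> (\<Prod>i\<in>UNIV. prob {\<omega> \<in> space M. L i (s $ i) \<omega> \<in> ball (x $ i) (e i)})"
      using \<kappa> bound s by (intro prod_mono) (auto intro: less_imp_le)
    also have "\<dots> = prob {\<omega> \<in> space M. \<forall>i. L i (s $ i) \<omega> \<in> ball (x $ i) (e i)}"
      using s(1) by (intro prob_multitime_box[symmetric] indep prob_space_axioms) auto
    also have "\<dots> \<le> prob ((\<lambda>\<omega>. \<chi> i. L i (s $ i) \<omega>) -` B \<inter> space M)"
    proof (rule finite_measure_mono)
      show "{\<omega> \<in> space M. \<forall>i. L i (s $ i) \<omega> \<in> ball (x $ i) (e i)}
          \<subseteq> (\<lambda>\<omega>. \<chi> i. L i (s $ i) \<omega>) -` B \<inter> space M"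
        using e(2) by (fastforce intro!: A(3))
      show "(\<lambda>\<omega>. \<chi> i. L i (s $ i) \<omega>) -` B \<inter> space M \<in> events"
        using meas B(1) by (auto intro: measurable_sets)
    qed
    finally show ?thesis
      using meas B(1)
      by (simp add: multitime_law_def emeasure_distr emeasure_eq_measure ennreal_leI)
  qed
  ultimately show ?thesis
    using \<kappa> by (intro exI[of _ "\<Prod>i\<in>UNIV. \<kappa> i"] exI[of _ U] conjI prod_pos) auto
qed

section \<open>The support of the restricted measure on the coordinate axes\<close>

lemma measure_support_ball_restriction_meets:
  fixes \<mu> :: "'a::{metric_space, second_countable_topology} measure"
  assumes "sets \<mu> = sets borel" "A \<in> sets borel" "A \<subseteq> ball a \<epsilon>" "0 < emeasure \<mu> A"
  shows "\<exists>x\<in>A. x \<in> measure_support (ball_restriction \<mu> a \<epsilon>)"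
  using assms
  by (intro measure_support_meets)
     (simp_all add: emeasure_ball_restriction Int_absorb2, simp add: ball_restriction_def)

text \<open>The image is the preimage of \<open>J\<close> under the \<open>i\<close>-th coordinate,
  cut with the closed \<open>i\<close>-th axis.\<close>

lemma borel_axis_image:
  assumes "J \<in> sets borel"
  shows "(\<lambda>r. r *\<^sub>R axis i 1) ` J \<in> sets (borel :: (real^'d::finite) measure)"
proof -
  have "(\<lambda>r. r *\<^sub>R axis i 1) ` J
      = {x. x $ i \<in> J} \<inter> {x. \<forall>j. j \<noteq> i \<longrightarrow> x $ j = (0::real)}"
  proof (intro equalityI subsetI)
    fix x :: "real^'d" assume x: "x \<in> {x. x $ i \<in> J} \<inter> {x. \<forall>j. j \<noteq> i \<longrightarrow> x $ j = 0}"
    then have "x = (x $ i) *\<^sub>R axis i 1"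
      by (auto simp: vec_eq_iff axis_def)
    with x show "x \<in> (\<lambda>r. r *\<^sub>R axis i 1) ` J"
      by blast
  qed (auto simp: axis_def)
  moreover have "{x. x $ i \<in> J} \<in> sets (borel :: (real^'d) measure)"
    using measurable_sets_borel[OF borel_measurable_nth assms, of i] by (simp add: vimage_def)
  moreover have "closed {x::real^'d. \<forall>j. j \<noteq> i \<longrightarrow> x $ j = 0}"
    by (intro closed_Collect_all closed_Collect_imp open_Collect_const closed_Collect_eq continuous_intros)
  ultimately show ?thesis
    by simp
qed

theorem proposition3p14:
  fixes M :: "'w measure"
    and L :: "'d::finite \<Rightarrow> real \<Rightarrow> 'w \<Rightarrow> real"
    and b :: "'d \<Rightarrow> real"
    and lam :: "'d \<Rightarrow> real measure"
    and T :: "real \<Rightarrow> 'w \<Rightarrow> real^'d"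
    and c :: "real^'d"
    and \<rho> \<Lambda> :: "(real^'d) measure"
  assumes dim: "CARD('d) \<ge> 2"
    and L_levy: "\<And>i. levy_process M (L i)"
    and L_triplet: "\<And>i. has_characteristic_triplet M (L i) (b i) (\<lambda>_. 0) (lam i)"
    and L_indep: "indep_processes M L"
    and T_subordinator: "subordinator M T"
    and T_triplet: "has_drift_triplet M T c (\<lambda>_. 0) \<rho>"
    and T_indep: "indep_of_family M T L"
    and c_nonneg: "c \<in> nonneg_orthant"
    and supp_rho: "measure_support \<rho> \<subseteq> nonneg_orthant"
    and Lambda_levy: "levy_measure \<Lambda>"
    and Lambda_eq: "\<And>B. B \<in> sets borel \<Longrightarrow> 0 \<notin> B \<Longrightarrow>
        emeasure \<Lambda> B =
          (\<integral>\<^sup>+ s \<in> nonneg_orthant. emeasure (multitime_law M L s) B \<partial>\<rho>) +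
          (\<Sum>i\<in>UNIV. ennreal (c $ i) * emeasure (lam i) {y. y *\<^sub>R axis i 1 \<in> B})"
    and lam_neg: "\<And>i \<epsilon>. \<epsilon> > 0 \<Longrightarrow> emeasure (lam i) {-\<epsilon><..<0} > 0"
    and lam_pos: "\<And>i \<epsilon>. \<epsilon> > 0 \<Longrightarrow> emeasure (lam i) {0<..<\<epsilon>} > 0"
    and nondegenerate: "c \<in> pos_orthant \<or> pos_orthant \<inter> measure_support \<rho> \<noteq> {}"
  shows "\<forall>\<epsilon>>0. 0 \<in> interior (convex hull (measure_support (ball_restriction \<Lambda> 0 \<epsilon>)))"
proof (intro allI impI)
  fix \<epsilon> :: real assume \<epsilon>: "0 < \<epsilon>"
  have [simp]: "sets \<Lambda> = sets borel"
    using Lambda_levy by (simp add: levy_measure_def)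
  have [simp, measurable_cong]: "sets \<rho> = sets borel"
    using T_triplet by (simp add: has_drift_triplet_def has_characteristic_triplet_def levy_measure_def)
  define S where "S = measure_support (ball_restriction \<Lambda> 0 \<epsilon>)"
  have axis_segment: "\<exists>r\<in>J. r *\<^sub>R axis i 1 \<in> S"
    if J: "open J" "J \<subseteq> {-\<epsilon><..<\<epsilon>} - {0}"
      and charged: "0 < emeasure \<Lambda> ((\<lambda>r. r *\<^sub>R axis i 1) ` J)" for i :: 'd and J
  proof -
    let ?B = "(\<lambda>r. r *\<^sub>R axis i 1) ` J :: (real^'d) set"
    have "?B \<in> sets borel"
      by (rule borel_axis_image) (use J(1) in simp)
    moreover have "?B \<subseteq> ball 0 \<epsilon>"
      using J(2) by (auto simp: norm_axis_1 subset_eq)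
    ultimately have "\<exists>x\<in>?B. x \<in> S"
      unfolding S_def using charged by (intro measure_support_ball_restriction_meets) auto
    then show ?thesis by blast
  qed
  have axes: "(\<exists>p>0. p *\<^sub>R axis i 1 \<in> S) \<and> (\<exists>q<0. q *\<^sub>R axis i 1 \<in> S)" for i
    using nondegenerate
  proof
    assume "c \<in> pos_orthant"
    then have c: "0 < c $ i"
      by (simp add: pos_orthant_def)
    have charged: "0 < emeasure \<Lambda> ((\<lambda>r. r *\<^sub>R axis i 1) ` J)"
      if J: "open J" "0 \<notin> J" "0 < emeasure (lam i) J" for J
    proof -
      let ?B = "(\<lambda>r. r *\<^sub>R axis i 1) ` J :: (real^'d) set"
      have "{y. y *\<^sub>R axis i 1 \<in> ?B} = J"
        by auto
      \<comment> \<open>The drift part alone suffices here: its \<open>i\<close>-th summand is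
        positive.\<close>
      then have "0 < ennreal (c $ i) * emeasure (lam i) {y. y *\<^sub>R axis i 1 \<in> ?B}"
        using c J(3) by (simp add: ennreal_zero_less_mult_iff)
      also have "\<dots> \<le> (\<Sum>i\<in>UNIV. ennreal (c $ i) * emeasure (lam i) {y. y *\<^sub>R axis i 1 \<in> ?B})"
        by (rule member_le_sum) auto
      also have "\<dots> \<le> emeasure \<Lambda> ?B"
        using J(1,2) by (subst Lambda_eq) (auto intro: borel_axis_image)
      finally show ?thesis .
    qed
    have "\<exists>r\<in>{0<..<\<epsilon>}. r *\<^sub>R axis i 1 \<in> S"
      using \<epsilon> lam_pos[OF \<epsilon>] by (intro axis_segment charged) auto
    moreover have "\<exists>r\<in>{-\<epsilon><..<0}. r *\<^sub>R axis i 1 \<in> S"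
      using \<epsilon> lam_neg[OF \<epsilon>] by (intro axis_segment charged) auto
    ultimately show ?thesis by auto
  next
    assume "pos_orthant \<inter> measure_support \<rho> \<noteq> {}"
    then obtain s\<^sub>0 where s\<^sub>0: "s\<^sub>0 \<in> pos_orthant" "s\<^sub>0 \<in> measure_support \<rho>"
      by auto
    \<comment> \<open>In this case \<open>\<Lambda>\<close> charges every nonempty open set that
      misses 0, through the integral over \<open>\<rho>\<close> alone.\<close>
    have charged: "0 < emeasure \<Lambda> B" if B: "open B" "x \<in> B" "0 \<notin> B" for B x
    proof -
      have supp: "x $ j \<in> measure_support (distr M borel (L j (s\<^sub>0 $ j)))" for j
        using s\<^sub>0(1) measure_support_levy_UNIV[OF L_levy L_triplet lam_neg lam_pos]
        by (simp add: pos_orthant_def)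
      obtain \<kappa> U where \<kappa>: "0 < \<kappa>" and U: "open U" "s\<^sub>0 \<in> U" "U \<subseteq> nonneg_orthant"
        and bound: "\<And>s. s \<in> U \<Longrightarrow> ennreal \<kappa> \<le> emeasure (multitime_law M L s) B"
        using multitime_law_locally_uniform_lower_bound[OF L_levy L_indep supp s\<^sub>0(1) B(1,2)] by blast
      \<comment> \<open>\<open>U\<close> is a neighbourhood of a support point of
        \<open>\<rho>\<close>, and the integrand is at least \<open>\<kappa>\<close> on it.\<close>
      have "0 < ennreal \<kappa> * emeasure \<rho> U"
        using \<kappa> U(1,2) s\<^sub>0(2) by (auto simp: measure_support_def ennreal_zero_less_mult_iff)
      also have "\<dots> = (\<integral>\<^sup>+ s. ennreal \<kappa> * indicator U s \<partial>\<rho>)"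
        using U(1) by (simp add: nn_integral_cmult_indicator)
      also have "\<dots> \<le> (\<integral>\<^sup>+ s \<in> nonneg_orthant. emeasure (multitime_law M L s) B \<partial>\<rho>)"
        using bound U(3) by (intro nn_integral_mono) (auto simp: indicator_def)
      also have "\<dots> \<le> emeasure \<Lambda> B"
        using B(1,3) by (subst Lambda_eq) auto
      finally show ?thesis .
    qed
    have "r *\<^sub>R axis i 1 \<in> S" if r: "r \<noteq> 0" "\<bar>r\<bar> < \<epsilon>" for r
      unfolding S_def measure_support_def
    proof (intro CollectI allI impI, elim conjE)
      fix V :: "(real^'d) set" assume V: "open V" "r *\<^sub>R axis i 1 \<in> V"
      \<comment> \<open>The origin is removed because the formula for \<open>\<Lambda>\<close>
        covers only sets without it.\<close>
      have "0 < emeasure \<Lambda> (V \<inter> ball 0 \<epsilon> - {0})"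
        using V r by (intro charged[of _ "r *\<^sub>R axis i 1"]) (auto simp: norm_axis_1 axis_eq_0_iff)
      also have "\<dots> \<le> emeasure \<Lambda> (V \<inter> ball 0 \<epsilon>)"
        using V(1) by (intro emeasure_mono) auto
      also have "\<dots> = emeasure (ball_restriction \<Lambda> 0 \<epsilon>) V"
        using V(1) by (simp add: emeasure_ball_restriction)
      finally show "0 < emeasure (ball_restriction \<Lambda> 0 \<epsilon>) V" .
    qed
    from this[of "\<epsilon> / 2"] this[of "- \<epsilon> / 2"] show ?thesis
      using \<epsilon> by (intro conjI exI[of _ "\<epsilon> / 2"] exI[of _ "- \<epsilon> / 2"]) auto
  qed
  then show "0 \<in> interior (convex hull (measure_support (ball_restriction \<Lambda> 0 \<epsilon>)))"
    unfolding S_def[symmetric] by (intro zero_in_interior_convex_hull_axes) auto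
qed

end
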